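(* Let $n\ge 2$, let $0<c<1$ and let $E\in \mathrm{UP}_n(c)$. Put $\beta=\dfrac{\log 2}{\log(3/c)}$. Then for every $a\in E$, $a\neq\infty$, $$\Lambda^\beta\bigl(E\cap \overline{B}^n(a,r)\bigr)\ \ge\ \frac{r^\beta}{2\cdot 3^n}\qquad\text{for all } 0<r<d(E)/2 .$$ Moreover, the Hausdorff dimension $\dim_H(E)$ of $E$ is at least $(\log 2)/\log(3/c)$.
   Context: $d(E)$ is the Euclidean diameter of $E$; $B^n(a,r)$ and $\overline{B}^n(a,r)$ are the open and closed Euclidean balls in $\mathbb{R}^n$. For $0<c<1$, $\mathrm{UP}_n(c)$ denotes the collection of compact sets $E\subset\mathbb{R}^n$ with at least two points such that $\{x\in E: cr<|x-a|<r\}\neq\emptyset$ for all $a\in E$ and all $0<r<d(E)/2$. (Since $E\subset\mathbb{R}^n$, the condition $a\ne\infty$ is automatic.) For $\beta>0$ the $\beta$-dimensional Hausdorff content of a set $E\subset \mathbb{R}^n$ is $\Lambda^\beta(E)=\inf\{\sum_k r_k^\beta : E\subset\bigcup_k B^n(a_k,r_k)\}$, the infimum being over countable coverings by balls. *)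

theory Defs
  imports "HOL-Analysis.Analysis"
begin

definition UP :: "real \<Rightarrow> (real ^ 'n) set set" where
  "UP c = {E. compact E \<and> (\<exists>x\<in>E. \<exists>y\<in>E. x \<noteq> y) \<and>
     (\<forall>a\<in>E. \<forall>r. 0 < r \<and> r < diameter E / 2 \<longrightarrow>
        {x \<in> E. c * r < norm (x - a) \<and> norm (x - a) < r} \<noteq> {})}"

(* Countable (finite or infinite) coverings are families indexed by an arbitrary set I of naturals.
   The content is meant for b > 0 and may be infinite, hence the values in ennreal, where
   every infinite sum exists. *)
definition hausdorff_content :: "real \<Rightarrow> (real ^ 'n) set \<Rightarrow> ennreal" where
  "hausdorff_content b E =
     Inf {(\<Sum>\<^sub>\<infinity>k\<in>I. ennreal (r k powr b)) | (I :: nat set) (a :: nat \<Rightarrow> real ^ 'n) (r :: nat \<Rightarrow> real).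
            (\<forall>k\<in>I. 0 < r k) \<and> E \<subseteq> (\<Union>k\<in>I. ball (a k) (r k))}"

(* The usual Hausdorff (outer) measure of dimension s > 0, up to normalisation. Boundedness of
   the covering sets is explicit because diameter is only meaningful on bounded sets. *)
definition hausdorff_premeasure :: "real \<Rightarrow> real \<Rightarrow> (real ^ 'n) set \<Rightarrow> ennreal" where
  "hausdorff_premeasure s \<delta> E =
     Inf {(\<Sum>\<^sub>\<infinity>k\<in>I. ennreal (diameter (U k) powr s)) | (I :: nat set) (U :: nat \<Rightarrow> (real ^ 'n) set).
            (\<forall>k\<in>I. bounded (U k) \<and> diameter (U k) \<le> \<delta>) \<and> E \<subseteq> (\<Union>k\<in>I. U k)}"

definition hausdorff_measure :: "real \<Rightarrow> (real ^ 'n) set \<Rightarrow> ennreal" where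
  "hausdorff_measure s E = (SUP \<delta>\<in>{0<..}. hausdorff_premeasure s \<delta> E)"

(* The infimum is over s > 0 because 0 powr 0 = 0 makes s = 0 degenerate; adding s = 0 with the
   counting measure would not change the value (the counting measure vanishes only on {}). *)
definition hausdorff_dim :: "(real ^ 'n) set \<Rightarrow> ennreal" where
  "hausdorff_dim E = Inf {ennreal s | s. 0 < s \<and> hausdorff_measure s E = 0}"

end

theory Submission
  imports Defs
begin

text \<open>
  Both claims come from a Cantor set inside \<open>E\<close> whose natural mass distribution is as spread out
  as a set of dimension \<open>\<beta>\<close> allows.

  Put \<open>q = c / 3\<close>, so that \<open>q powr \<beta> = 1 / 2\<close>. Uniform perfectness, used at the point \<open>x\<close> with
  radius \<open>2 * \<rho> / 3\<close>, gives a second point \<open>x'\<close> of \<open>E\<close> with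
  \<open>2 * q * \<rho> < dist x x' < 2 * \<rho> / 3\<close>. Hence the closed balls of radius \<open>q * \<rho>\<close> about \<open>x\<close> and
  \<open>x'\<close> are disjoint and both lie in the closed ball of radius \<open>\<rho>\<close> about \<open>x\<close>. Iterating from
  \<open>(a, r)\<close> gives at depth \<open>N\<close> exactly \<open>2 ^ N\<close> points of \<open>E \<inter> cball a r\<close>, centres of disjoint
  balls of radius \<open>q ^ N * r\<close>. Instead of passing to a limit measure, the proof counts these
  points: compactness of \<open>E \<inter> cball a r\<close> reduces a covering to a finite one, and then some single
  depth \<open>N\<close> is fine enough for all its balls.

  The key estimate (\<open>card_tips_Int_ball_powr\<close>) is that a ball of radius \<open>s \<ge> q ^ N * r\<close> contains
  at most the fraction \<open>2 * 3 ^ n * (s / r) powr \<beta>\<close> of the points of depth \<open>N\<close>. Indeed, if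
  \<open>q ^ Suc i * r \<le> s < q ^ i * r\<close>, comparison of volumes shows that the ball meets at most
  \<open>3 ^ n\<close> of the disjoint balls of depth \<open>i\<close>, each of which carries the fraction
  \<open>1 / 2 ^ i \<le> 2 * (s / r) powr \<beta>\<close> of the points. Summing over a covering gives the lower bound
  for the content.

  For the dimension, a covering with small sum of \<open>diameter (U k) powr s\<close>, where \<open>s \<le> \<beta>\<close>, can be
  replaced by a covering by balls with small sum of \<open>r k powr \<beta>\<close>. So a null set of the
  \<open>s\<close>-dimensional measure has \<open>\<beta>\<close>-dimensional content zero, which the first part excludes.
\<close>

section \<open>Binary branching and the tips of its tree\<close>

text \<open>
  The function \<open>h\<close> chooses the second child: the ball of radius \<open>\<rho>\<close> about \<open>x\<close> has as children the
  balls of radius \<open>q * \<rho>\<close> about \<open>x\<close> and \<open>h \<rho> x\<close>. The two inequalities make the children disjoint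
  and keep them inside their parent.
\<close>

locale binary_branching =
  fixes E :: "'a::euclidean_space set" and h :: "real \<Rightarrow> 'a \<Rightarrow> 'a" and q R :: real
  assumes q_pos: "0 < q" and q_less_1: "q < 1"
    and branch_in: "\<lbrakk>x \<in> E; 0 < \<rho>; \<rho> \<le> R\<rbrakk> \<Longrightarrow> h \<rho> x \<in> E"
    and branch_apart: "\<lbrakk>x \<in> E; 0 < \<rho>; \<rho> \<le> R\<rbrakk> \<Longrightarrow> 2 * (q * \<rho>) < dist x (h \<rho> x)"
    and branch_near: "\<lbrakk>x \<in> E; 0 < \<rho>; \<rho> \<le> R\<rbrakk> \<Longrightarrow> dist x (h \<rho> x) \<le> (1 - q) * \<rho>"
begin

primrec tips :: "nat \<Rightarrow> real \<Rightarrow> 'a \<Rightarrow> 'a set" where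
  "tips 0 \<rho> x = {x}"
| "tips (Suc j) \<rho> x = tips j (q * \<rho>) x \<union> tips j (q * \<rho>) (h \<rho> x)"

lemma scaled_radius:
  assumes "0 < \<rho>" "\<rho> \<le> R"
  shows "0 < q * \<rho>" "q * \<rho> \<le> R"
proof -
  show "0 < q * \<rho>"
    using assms q_pos by simp
  have "q * \<rho> \<le> 1 * \<rho>"
    using assms q_less_1 by (intro mult_right_mono) auto
  then show "q * \<rho> \<le> R"
    using assms by linarith
qed

lemma scaled_radius_power:
  assumes "0 < \<rho>" "\<rho> \<le> R"
  shows "0 < q ^ i * \<rho>" "q ^ i * \<rho> \<le> R"
proof -
  have "0 < q ^ i * \<rho> \<and> q ^ i * \<rho> \<le> R"
  proof (induction i)
    case (Suc i)
    then show ?case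
      using scaled_radius[of "q ^ i * \<rho>"] by (simp add: mult.assoc)
  qed (use assms in simp)
  then show "0 < q ^ i * \<rho>" "q ^ i * \<rho> \<le> R" by auto
qed

lemma child_balls_subset:
  assumes "x \<in> E" "0 < \<rho>" "\<rho> \<le> R"
  shows "cball x (q * \<rho>) \<subseteq> cball x \<rho>" "cball (h \<rho> x) (q * \<rho>) \<subseteq> cball x \<rho>"
proof -
  have "q * \<rho> \<le> 1 * \<rho>"
    using assms q_less_1 by (intro mult_right_mono) auto
  then show "cball x (q * \<rho>) \<subseteq> cball x \<rho>" by (intro subset_cball) simp
  have "dist (h \<rho> x) x + q * \<rho> \<le> \<rho>"
    using branch_near[OF assms] by (simp add: dist_commute algebra_simps)
  then show "cball (h \<rho> x) (q * \<rho>) \<subseteq> cball x \<rho>"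
    by (simp add: cball_subset_cball_iff)
qed

lemma child_balls_disjnt:
  assumes "x \<in> E" "0 < \<rho>" "\<rho> \<le> R"
  shows "disjnt (cball x (q * \<rho>)) (cball (h \<rho> x) (q * \<rho>))"
  using branch_apart[OF assms] unfolding disjnt_def by (intro disjoint_cballI) linarith

lemma finite_tips: "finite (tips j \<rho> x)"
  by (induction j arbitrary: \<rho> x) auto

lemma tips_subset: "\<lbrakk>x \<in> E; 0 < \<rho>; \<rho> \<le> R\<rbrakk> \<Longrightarrow> tips j \<rho> x \<subseteq> E"
proof (induction j arbitrary: \<rho> x)
  case (Suc j)
  then show ?case
    using branch_in scaled_radius by auto
qed simp

lemma tip_balls_subset:
  "\<lbrakk>x \<in> E; 0 < \<rho>; \<rho> \<le> R; y \<in> tips j \<rho> x\<rbrakk> \<Longrightarrow> cball y (q ^ j * \<rho>) \<subseteq> cball x \<rho>"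
proof (induction j arbitrary: \<rho> x)
  case (Suc j)
  note \<rho>' = scaled_radius[OF Suc.prems(2,3)]
  have x': "h \<rho> x \<in> E" using Suc.prems branch_in by blast
  have "cball y (q ^ j * (q * \<rho>)) \<subseteq> cball x (q * \<rho>) \<or>
        cball y (q ^ j * (q * \<rho>)) \<subseteq> cball (h \<rho> x) (q * \<rho>)"
    using Suc.IH[OF Suc.prems(1) \<rho>'] Suc.IH[OF x' \<rho>'] Suc.prems(4)
    unfolding tips.simps by blast
  then have "cball y (q ^ j * (q * \<rho>)) \<subseteq> cball x \<rho>"
    using child_balls_subset[OF Suc.prems(1-3)] by (meson subset_trans)
  then show ?case by (simp add: mult.assoc mult.left_commute)
qed simp

lemma tips_subset_cball:
  assumes "x \<in> E" "0 < \<rho>" "\<rho> \<le> R"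
  shows "tips j \<rho> x \<subseteq> cball x \<rho>"
proof
  fix y assume "y \<in> tips j \<rho> x"
  with tip_balls_subset[OF assms] have "cball y (q ^ j * \<rho>) \<subseteq> cball x \<rho>" .
  moreover have "y \<in> cball y (q ^ j * \<rho>)"
    using scaled_radius_power[OF assms(2,3), of j] by simp
  ultimately show "y \<in> cball x \<rho>" by blast
qed

lemma tip_balls_disjnt:
  "\<lbrakk>x \<in> E; 0 < \<rho>; \<rho> \<le> R; y \<in> tips j \<rho> x; z \<in> tips j \<rho> x; y \<noteq> z\<rbrakk>
    \<Longrightarrow> disjnt (cball y (q ^ j * \<rho>)) (cball z (q ^ j * \<rho>))"
proof (induction j arbitrary: \<rho> x)
  case (Suc j)
  let ?x' = "h \<rho> x"
  note \<rho>' = scaled_radius[OF Suc.prems(2,3)]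
  have x': "?x' \<in> E" using Suc.prems branch_in by blast
  have sub: "cball w (q ^ Suc j * \<rho>) \<subseteq> cball v (q * \<rho>)"
    if "v \<in> E" "w \<in> tips j (q * \<rho>) v" for v w
    using tip_balls_subset[OF that(1) \<rho>' that(2)] by (simp add: mult.assoc mult.left_commute)
  have IH: "disjnt (cball y (q ^ Suc j * \<rho>)) (cball z (q ^ Suc j * \<rho>))"
    if "v \<in> E" "y \<in> tips j (q * \<rho>) v" "z \<in> tips j (q * \<rho>) v" for v
    using Suc.IH[OF that(1) \<rho>' that(2,3) Suc.prems(6)] by (simp add: mult.assoc mult.left_commute)
  have apart: "disjnt (cball x (q * \<rho>)) (cball ?x' (q * \<rho>))"
    using child_balls_disjnt Suc.prems by blast
  consider "y \<in> tips j (q * \<rho>) x" "z \<in> tips j (q * \<rho>) x"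
    | "y \<in> tips j (q * \<rho>) ?x'" "z \<in> tips j (q * \<rho>) ?x'"
    | "y \<in> tips j (q * \<rho>) x" "z \<in> tips j (q * \<rho>) ?x'"
    | "y \<in> tips j (q * \<rho>) ?x'" "z \<in> tips j (q * \<rho>) x"
    using Suc.prems(4,5) by auto
  then show ?case
  proof cases
    case 1 then show ?thesis using IH Suc.prems(1) by blast
  next
    case 2 then show ?thesis using IH x' by blast
  next
    case 3
    then show ?thesis
      using apart sub[OF Suc.prems(1) 3(1)] sub[OF x' 3(2)] by (meson disjnt_subset1 disjnt_subset2)
  next
    case 4
    then show ?thesis
      using apart sub[OF x' 4(1)] sub[OF Suc.prems(1) 4(2)]
      by (meson disjnt_subset1 disjnt_subset2 disjnt_sym)
  qed
qed simp

lemma card_tips: "\<lbrakk>x \<in> E; 0 < \<rho>; \<rho> \<le> R\<rbrakk> \<Longrightarrow> card (tips j \<rho> x) = 2 ^ j"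
proof (induction j arbitrary: \<rho> x)
  case (Suc j)
  note \<rho>' = scaled_radius[OF Suc.prems(2,3)]
  have x': "h \<rho> x \<in> E" using Suc.prems branch_in by blast
  have "tips j (q * \<rho>) x \<inter> tips j (q * \<rho>) (h \<rho> x) = {}"
    using child_balls_disjnt[OF Suc.prems] tips_subset_cball[OF Suc.prems(1) \<rho>', of j]
      tips_subset_cball[OF x' \<rho>', of j]
    unfolding disjnt_def by blast
  then show ?case
    using Suc.IH[OF Suc.prems(1) \<rho>'] Suc.IH[OF x' \<rho>'] by (simp add: card_Un_disjoint finite_tips)
qed simp

lemma tips_add: "tips (i + j) \<rho> x = (\<Union>y\<in>tips i \<rho> x. tips j (q ^ i * \<rho>) y)"
  by (induction i arbitrary: \<rho> x) (auto simp: mult.assoc mult.left_commute)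

end

section \<open>Counting tips in a ball\<close>

text \<open>The balls about \<open>S\<close> are disjoint and have \<open>1 / K ^ n\<close> of the volume of the ball that
  contains them.\<close>

lemma card_disjoint_balls_le:
  fixes S :: "'a::euclidean_space set"
  assumes "finite S" "0 < \<rho>" "0 \<le> K"
    and disj: "pairwise (\<lambda>z w. disjnt (cball z \<rho>) (cball w \<rho>)) S"
    and sub: "\<And>z. z \<in> S \<Longrightarrow> cball z \<rho> \<subseteq> cball y (K * \<rho>)"
  shows "real (card S) \<le> K ^ DIM('a)"
proof -
  let ?v = "unit_ball_vol (real DIM('a))"
  have "disjoint_family_on (\<lambda>z. cball z \<rho>) S"
    using disj by (auto simp: disjoint_family_on_def pairwise_def disjnt_def)
  then have "measure lebesgue (\<Union>z\<in>S. cball z \<rho>) = (\<Sum>z\<in>S. measure lebesgue (cball z \<rho>))"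
    using assms(1) by (intro measure_finite_Union) (auto simp: emeasure_cball less_imp_le[OF assms(2)])
  also have "\<dots> = real (card S) * (?v * \<rho> ^ DIM('a))"
    using assms(2) by (simp add: content_cball)
  finally have eq: "measure lebesgue (\<Union>z\<in>S. cball z \<rho>) = real (card S) * (?v * \<rho> ^ DIM('a))" .
  have "measure lebesgue (\<Union>z\<in>S. cball z \<rho>) \<le> measure lebesgue (cball y (K * \<rho>))"
    using assms(1) sub by (intro measure_mono_fmeasurable) (auto intro!: sets.finite_UN)
  also have "\<dots> = K ^ DIM('a) * (?v * \<rho> ^ DIM('a))"
    using assms(2,3) by (simp add: content_cball power_mult_distrib)
  finally have "real (card S) * (?v * \<rho> ^ DIM('a)) \<le> K ^ DIM('a) * (?v * \<rho> ^ DIM('a))"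
    unfolding eq .
  moreover have "0 < ?v * \<rho> ^ DIM('a)"
    using assms(2) by (simp add: unit_ball_vol_pos)
  ultimately show ?thesis
    by (simp only: mult_le_cancel_right_pos)
qed

context binary_branching
begin

text \<open>A ball of radius \<open>s \<le> q ^ i * \<rho>\<close> meets at most \<open>3 ^ n\<close> balls of depth \<open>i\<close>, since all of them
  lie in the concentric ball of radius \<open>3 * (q ^ i * \<rho>)\<close>.\<close>

lemma card_tips_Int_ball:
  assumes "x \<in> E" "0 < \<rho>" "\<rho> \<le> R" and s: "s \<le> q ^ i * \<rho>"
  shows "real (card (tips (i + j) \<rho> x \<inter> ball y s)) \<le> 3 ^ DIM('a) * 2 ^ j"
proof -
  let ?t = "q ^ i * \<rho>"
  define S where "S = {z \<in> tips i \<rho> x. cball z ?t \<inter> ball y s \<noteq> {}}"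
  note t = scaled_radius_power[OF assms(2,3), of i]
  have S: "finite S" "S \<subseteq> E"
    using finite_tips tips_subset[OF assms(1-3), of i] by (auto simp: S_def)
  have "tips (i + j) \<rho> x \<inter> ball y s \<subseteq> (\<Union>z\<in>S. tips j ?t z)"
  proof
    fix w assume w: "w \<in> tips (i + j) \<rho> x \<inter> ball y s"
    then obtain z where z: "z \<in> tips i \<rho> x" "w \<in> tips j ?t z"
      by (auto simp: tips_add)
    then have "w \<in> cball z ?t"
      using tips_subset_cball[OF _ t] tips_subset[OF assms(1-3)] by blast
    with w z have "z \<in> S" by (auto simp: S_def)
    with z show "w \<in> (\<Union>z\<in>S. tips j ?t z)" by blast
  qed
  then have "card (tips (i + j) \<rho> x \<inter> ball y s) \<le> card (\<Union>z\<in>S. tips j ?t z)"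
    using S(1) finite_tips by (intro card_mono) auto
  also have "\<dots> \<le> (\<Sum>z\<in>S. card (tips j ?t z))"
    using S(1) by (rule card_UN_le)
  also have "\<dots> = card S * 2 ^ j"
    using S(2) t by (simp add: card_tips subset_iff)
  finally have "real (card (tips (i + j) \<rho> x \<inter> ball y s)) \<le> real (card S) * 2 ^ j"
    by (metis of_nat_le_iff of_nat_mult of_nat_numeral of_nat_power)
  also have "real (card S) \<le> 3 ^ DIM('a)"
  proof (rule card_disjoint_balls_le[OF S(1) t(1)])
    show "pairwise (\<lambda>z w. disjnt (cball z ?t) (cball w ?t)) S"
      using tip_balls_disjnt[OF assms(1-3)] by (auto simp: pairwise_def S_def)
    fix z assume "z \<in> S"
    then obtain w where "dist z w \<le> ?t" "dist y w < s"
      by (auto simp: S_def)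
    then have "dist z y \<le> 2 * ?t"
      using s dist_triangle2[of z y w] by linarith
    then show "cball z ?t \<subseteq> cball y (3 * ?t)"
      unfolding cball_subset_cball_iff by linarith
  qed simp
  finally show ?thesis by (simp add: mult_right_mono)
qed

lemma card_tips_Int_ball_powr:
  assumes "x \<in> E" "0 < \<rho>" "\<rho> \<le> R" and s: "q ^ N * \<rho> \<le> s"
    and \<beta>: "0 \<le> \<beta>" "q powr \<beta> = 1 / 2"
  shows "real (card (tips N \<rho> x \<inter> ball y s)) \<le> 2 * 3 ^ DIM('a) * 2 ^ N * (s / \<rho>) powr \<beta>"
proof -
  have powr_ge: "(1 / 2) ^ m \<le> (s / \<rho>) powr \<beta>" if "q ^ m * \<rho> \<le> s" for m
  proof -
    have "(1 / 2) ^ m = q powr (real m * \<beta>)"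
      using q_pos powr_power[of q \<beta> m] unfolding \<beta>(2) by auto
    also have "\<dots> = (q ^ m) powr \<beta>"
      using q_pos by (simp add: powr_powr flip: powr_realpow)
    also have "\<dots> \<le> (s / \<rho>) powr \<beta>"
      using that assms(2) \<beta>(1) q_pos by (intro powr_mono2) (auto simp: field_simps)
    finally show ?thesis .
  qed
  define m where "m = (LEAST m. q ^ m * \<rho> \<le> s)"
  have m: "q ^ m * \<rho> \<le> s" "m \<le> N"
    using s unfolding m_def by (auto intro: LeastI Least_le)
  show ?thesis
  proof (cases m)
    \<comment> \<open>Here \<open>s \<ge> \<rho>\<close>, and the trivial bound \<open>2 ^ N\<close> for the number of tips suffices.\<close>
    case 0
    have "real (card (tips N \<rho> x \<inter> ball y s)) \<le> real (card (tips N \<rho> x))"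
      using finite_tips by (simp add: card_mono)
    also have "\<dots> = 1 * 2 ^ N * 1"
      using card_tips[OF assms(1-3)] by simp
    also have "\<dots> \<le> (2 * 3 ^ DIM('a)) * 2 ^ N * (s / \<rho>) powr \<beta>"
    proof (intro mult_mono)
      have "(1::real) \<le> 3 ^ DIM('a)" by simp
      then show "(1::real) \<le> 2 * 3 ^ DIM('a)" by linarith
      show "1 \<le> (s / \<rho>) powr \<beta>" using powr_ge[of 0] m 0 by simp
    qed auto
    finally show ?thesis by simp
  next
    case (Suc i)
    have "\<not> q ^ i * \<rho> \<le> s"
      using not_less_Least[of i "\<lambda>m. q ^ m * \<rho> \<le> s"] Suc by (simp add: m_def)
    then have "real (card (tips (i + (N - i)) \<rho> x \<inter> ball y s)) \<le> 3 ^ DIM('a) * 2 ^ (N - i)"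
      using assms by (intro card_tips_Int_ball) auto
    also have "2 ^ (N - i) = (2::real) * 2 ^ N * (1 / 2) ^ Suc i"
      using m(2) Suc by (simp add: power_diff power_divide)
    also have "3 ^ DIM('a) * \<dots> \<le> 3 ^ DIM('a) * (2 * 2 ^ N * (s / \<rho>) powr \<beta>)"
      using powr_ge[of "Suc i"] m Suc by (intro mult_left_mono) auto
    finally show ?thesis
      using m(2) Suc by (simp add: mult_ac)
  qed
qed

text \<open>The given balls contain all \<open>2 ^ N\<close> tips, for \<open>N\<close> so large that \<open>q ^ N * \<rho>\<close> is below the
  radius of each of them.\<close>

lemma finite_cover_sum_ge:
  assumes "x \<in> E" "0 < \<rho>" "\<rho> \<le> R" and \<beta>: "0 \<le> \<beta>" "q powr \<beta> = 1 / 2"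
    and I: "finite I" "\<And>k. k \<in> I \<Longrightarrow> 0 < r k"
    and cover: "E \<inter> cball x \<rho> \<subseteq> (\<Union>k\<in>I. ball (b k) (r k))"
  shows "\<rho> powr \<beta> / (2 * 3 ^ DIM('a)) \<le> (\<Sum>k\<in>I. r k powr \<beta>)"
proof -
  have "(\<lambda>N. q ^ N * \<rho>) \<longlonglongrightarrow> 0"
    using q_pos q_less_1 by (intro tendsto_mult_left_zero LIMSEQ_realpow_zero) auto
  then have "\<forall>k\<in>I. \<forall>\<^sub>F N in sequentially. q ^ N * \<rho> < r k"
    using I(2) by (auto dest: order_tendstoD(2))
  then have "\<forall>\<^sub>F N in sequentially. \<forall>k\<in>I. q ^ N * \<rho> < r k"
    using I(1) by (simp add: eventually_ball_finite_distrib)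
  then obtain N where N: "\<And>k. k \<in> I \<Longrightarrow> q ^ N * \<rho> < r k"
    by (auto simp: eventually_sequentially)
  have "tips N \<rho> x = (\<Union>k\<in>I. tips N \<rho> x \<inter> ball (b k) (r k))"
    using tips_subset[OF assms(1-3), of N] tips_subset_cball[OF assms(1-3), of N] cover by blast
  then have "card (tips N \<rho> x) \<le> (\<Sum>k\<in>I. card (tips N \<rho> x \<inter> ball (b k) (r k)))"
    using card_UN_le[OF I(1), of "\<lambda>k. tips N \<rho> x \<inter> ball (b k) (r k)"] by simp
  then have "2 ^ N \<le> (\<Sum>k\<in>I. card (tips N \<rho> x \<inter> ball (b k) (r k)))"
    using card_tips[OF assms(1-3)] by simp
  then have "2 ^ N \<le> (\<Sum>k\<in>I. real (card (tips N \<rho> x \<inter> ball (b k) (r k))))"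
    by (metis of_nat_le_iff of_nat_numeral of_nat_power of_nat_sum)
  also have "\<dots> \<le> (\<Sum>k\<in>I. 2 * 3 ^ DIM('a) * 2 ^ N * (r k / \<rho>) powr \<beta>)"
    using N by (intro sum_mono card_tips_Int_ball_powr[OF assms(1-3) _ \<beta>]) (auto intro: less_imp_le)
  also have "\<dots> = 2 ^ N * (2 * 3 ^ DIM('a) * (\<Sum>k\<in>I. r k powr \<beta>) / \<rho> powr \<beta>)"
    using I(2) assms(2)
    by (simp add: sum_distrib_left sum_divide_distrib powr_divide less_imp_le mult_ac)
  finally have "2 ^ N * 1 \<le> 2 ^ N * (2 * 3 ^ DIM('a) * (\<Sum>k\<in>I. r k powr \<beta>) / \<rho> powr \<beta>)"
    by simp
  then have "1 \<le> 2 * 3 ^ DIM('a) * (\<Sum>k\<in>I. r k powr \<beta>) / \<rho> powr \<beta>"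
    by (rule mult_left_le_imp_le) simp
  then show ?thesis
    using assms(2) by (simp add: field_simps)
qed

end

section \<open>Hausdorff content\<close>

lemma hausdorff_content_mono:
  assumes "A \<subseteq> B"
  shows "hausdorff_content s A \<le> hausdorff_content s B"
  unfolding hausdorff_content_def using assms by (intro Inf_superset_mono) blast

lemma sum_le_infsum_ennreal:
  fixes f :: "'b \<Rightarrow> ennreal"
  assumes "finite F" "F \<subseteq> I"
  shows "sum f F \<le> infsum f I"
  using assms by (auto simp: nonneg_infsum_complete intro: SUP_upper)

lemma hausdorff_content_branching_ge:
  fixes E :: "(real ^ 'n) set"
  assumes "binary_branching E h q R" "compact E" "x \<in> E" "0 < \<rho>" "\<rho> \<le> R"
    and \<beta>: "0 \<le> \<beta>" "q powr \<beta> = 1 / 2"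
  shows "ennreal (\<rho> powr \<beta> / (2 * 3 ^ CARD('n))) \<le> hausdorff_content \<beta> (E \<inter> cball x \<rho>)"
  unfolding hausdorff_content_def
proof (rule Inf_greatest, safe)
  interpret binary_branching E h q R by fact
  fix I :: "nat set" and b :: "nat \<Rightarrow> real ^ 'n" and r :: "nat \<Rightarrow> real"
  assume r: "\<forall>k\<in>I. 0 < r k" and cover: "E \<inter> cball x \<rho> \<subseteq> (\<Union>k\<in>I. ball (b k) (r k))"
  have "compact (E \<inter> cball x \<rho>)"
    using assms(2) by (simp add: compact_Int_closed)
  then obtain J where J: "J \<subseteq> I" "finite J" "E \<inter> cball x \<rho> \<subseteq> (\<Union>k\<in>J. ball (b k) (r k))"
    by (rule compactE_image[OF _ _ cover]) auto
  have "ennreal (\<rho> powr \<beta> / (2 * 3 ^ CARD('n))) \<le> ennreal (\<Sum>k\<in>J. r k powr \<beta>)"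
    using finite_cover_sum_ge[OF assms(3-5) \<beta> J(2) _ J(3)] r J(1) by (intro ennreal_leI) auto
  also have "\<dots> = (\<Sum>k\<in>J. ennreal (r k powr \<beta>))"
    by simp
  also have "\<dots> \<le> (\<Sum>\<^sub>\<infinity>k\<in>I. ennreal (r k powr \<beta>))"
    using J(2,1) by (rule sum_le_infsum_ennreal)
  finally show "ennreal (\<rho> powr \<beta> / (2 * 3 ^ CARD('n))) \<le> (\<Sum>\<^sub>\<infinity>k\<in>I. ennreal (r k powr \<beta>))" .
qed

text \<open>
  A covering set \<open>U k\<close> lies in every open ball of radius larger than its diameter \<open>d k\<close> about one
  of its points. The radius is taken with \<open>r k powr s = d k powr s + e * (1 / 2) ^ Suc k\<close>, which
  also copes with \<open>d k = 0\<close> and adds at most \<open>e\<close> to the sum. When \<open>e\<close> and the given sum are at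
  most \<open>1 / 2\<close>, the radii are at most \<open>1\<close>, so that raising the exponent from \<open>s\<close> to \<open>\<beta>\<close> only decreases the terms.
\<close>

lemma hausdorff_content_eq_0:
  fixes E :: "(real ^ 'n) set"
  assumes "0 < s" "s \<le> \<beta>" and null: "hausdorff_measure s E = 0"
  shows "hausdorff_content \<beta> E = 0"
proof -
  have le: "hausdorff_content \<beta> E \<le> 0 + ennreal \<epsilon>" if "0 < \<epsilon>" for \<epsilon>
  proof -
    define e where "e = min \<epsilon> 1 / 2"
    have e: "0 < e" "e \<le> 1 / 2" "2 * e \<le> \<epsilon>" using \<open>0 < \<epsilon>\<close> by (auto simp: e_def)
    have "hausdorff_premeasure s 1 E \<le> hausdorff_measure s E"
      unfolding hausdorff_measure_def by (intro SUP_upper) auto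
    then have "hausdorff_premeasure s 1 E < ennreal e"
      using null e by simp
    then obtain I :: "nat set" and U :: "nat \<Rightarrow> (real ^ 'n) set" where
      U: "\<And>k. k \<in> I \<Longrightarrow> bounded (U k)" "E \<subseteq> (\<Union>k\<in>I. U k)"
      and small: "(\<Sum>\<^sub>\<infinity>k\<in>I. ennreal (diameter (U k) powr s)) < ennreal e"
      unfolding hausdorff_premeasure_def Inf_less_iff by blast
    define d where "d k = diameter (U k) powr s" for k
    define g where "g k = e * (1 / 2) ^ Suc k" for k :: nat
    define r where "r k = (d k + g k) powr (1 / s)" for k
    define b where "b k = (SOME x. x \<in> U k)" for k
    have g: "0 < g k" "g k \<le> e" for k
      using e power_le_one[of "1 / 2 :: real" "Suc k"] by (auto simp: g_def intro!: mult_left_le)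
    have d: "0 \<le> d k" for k by (simp add: d_def)
    have r_pos: "0 < r k" for k
      using g[of k] d[of k] by (simp add: r_def)
    have r_powr: "r k powr s = d k + g k" for k
      using g[of k] d[of k] assms(1) by (simp add: r_def powr_powr)
    have d_sum: "(\<Sum>k\<in>F. d k) \<le> e" if "finite F" "F \<subseteq> I" for F
    proof -
      have "ennreal (\<Sum>k\<in>F. d k) = (\<Sum>k\<in>F. ennreal (d k))"
        using d by simp
      also have "\<dots> \<le> (\<Sum>\<^sub>\<infinity>k\<in>I. ennreal (d k))"
        using that by (rule sum_le_infsum_ennreal)
      also have "\<dots> \<le> ennreal e"
        using small by (simp add: d_def)
      finally show ?thesis using e by simp
    qed
    have "g sums e"
      using sums_mult[OF power_half_series, of e] by (simp add: g_def[abs_def])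
    then have g_sum: "sum g F \<le> e" if "finite F" for F
      using sum_le_suminf[of g F] that g(1) by (auto simp: sums_iff intro: less_imp_le)
    have "U k \<subseteq> ball (b k) (r k)" if "k \<in> I" for k
    proof
      fix x assume x: "x \<in> U k"
      then have "b k \<in> U k" unfolding b_def by (rule someI)
      then have "dist (b k) x \<le> diameter (U k)"
        using x U(1)[OF that] by (intro diameter_bounded_bound)
      also have "diameter (U k) < r k"
      proof (rule ccontr)
        assume "\<not> diameter (U k) < r k"
        then have "r k powr s \<le> d k"
          unfolding d_def using assms(1) r_pos[of k] by (intro powr_mono2) auto
        then show False using r_powr[of k] g(1)[of k] by linarith
      qed
      finally show "x \<in> ball (b k) (r k)" by simp
    qed
    then have "E \<subseteq> (\<Union>k\<in>I. ball (b k) (r k))"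
      using U(2) by blast
    then have "hausdorff_content \<beta> E \<le> (\<Sum>\<^sub>\<infinity>k\<in>I. ennreal (r k powr \<beta>))"
      unfolding hausdorff_content_def using r_pos by (intro Inf_lower) blast
    also have "\<dots> \<le> ennreal \<epsilon>"
    proof (rule infsum_le_finite_sums)
      show "(\<lambda>k. ennreal (r k powr \<beta>)) summable_on I"
        by (rule nonneg_summable_on_complete) simp
      fix F assume F: "finite F" "F \<subseteq> I"
      have "r k powr \<beta> \<le> d k + g k" if "k \<in> F" for k
      proof -
        have "d k \<le> e" using d_sum[of "{k}"] F that by auto
        then have "d k + g k \<le> 1" using g(2)[of k] e by linarith
        then have "r k \<le> 1"
          using g[of k] d[of k] assms(1) by (auto simp: r_def intro!: powr_le1)
        then have "r k powr \<beta> \<le> r k powr s"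
          using assms(2) r_pos[of k] by (intro powr_mono') auto
        then show ?thesis by (simp add: r_powr)
      qed
      then have "(\<Sum>k\<in>F. r k powr \<beta>) \<le> (\<Sum>k\<in>F. d k + g k)"
        by (rule sum_mono)
      also have "\<dots> \<le> \<epsilon>"
        using d_sum[OF F] g_sum[OF F(1)] e by (simp add: sum.distrib)
      finally show "(\<Sum>k\<in>F. ennreal (r k powr \<beta>)) \<le> ennreal \<epsilon>"
        by (simp add: ennreal_leI)
    qed
    finally show ?thesis by simp
  qed
  have "hausdorff_content \<beta> E \<le> 0"
    by (rule ennreal_le_epsilon) (use le in auto)
  then show ?thesis by simp
qed

section \<open>Uniformly perfect sets\<close>

lemma UP_binary_branching:
  assumes "E \<in> UP c" "0 < c" "c < 1" "R < diameter E / 2"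
  obtains h where "binary_branching E h (c / 3) R"
proof -
  have "\<exists>y\<in>E. 2 * (c / 3 * \<rho>) < dist x y \<and> dist x y \<le> (1 - c / 3) * \<rho>"
    if "x \<in> E" "0 < \<rho>" "\<rho> \<le> R" for x \<rho>
  proof -
    \<comment> \<open>At radius \<open>2 * \<rho> / 3\<close> there is room for a ball of radius \<open>c * \<rho> / 3\<close>, as \<open>2 / 3 + c / 3 < 1\<close>,
      and the lower bound is exactly twice that radius.\<close>
    have "0 < 2 * \<rho> / 3" "2 * \<rho> / 3 < diameter E / 2"
      using that assms(4) by auto
    then have "{y \<in> E. c * (2 * \<rho> / 3) < norm (y - x) \<and> norm (y - x) < 2 * \<rho> / 3} \<noteq> {}"
      using assms(1) that(1) unfolding UP_def by blast
    then obtain y where y: "y \<in> E" "c * (2 * \<rho> / 3) < dist x y" "dist x y < 2 * \<rho> / 3"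
      by (auto simp: dist_norm norm_minus_commute)
    have "2 / 3 * \<rho> \<le> (1 - c / 3) * \<rho>"
      using assms(3) that(2) by (intro mult_right_mono) auto
    with y show ?thesis by (intro bexI[of _ y]) auto
  qed
  then have "\<forall>\<rho> x. \<exists>y. x \<in> E \<and> 0 < \<rho> \<and> \<rho> \<le> R \<longrightarrow>
      y \<in> E \<and> 2 * (c / 3 * \<rho>) < dist x y \<and> dist x y \<le> (1 - c / 3) * \<rho>"
    by blast
  then obtain h where
    "\<forall>\<rho> x. x \<in> E \<and> 0 < \<rho> \<and> \<rho> \<le> R \<longrightarrow>
      h \<rho> x \<in> E \<and> 2 * (c / 3 * \<rho>) < dist x (h \<rho> x) \<and> dist x (h \<rho> x) \<le> (1 - c / 3) * \<rho>"
    by metis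
  then have "binary_branching E h (c / 3) R"
    using assms(2,3) by unfold_locales auto
  then show thesis by (rule that)
qed

theorem lemma1p1:
  fixes E :: "(real ^ 'n) set" and c \<beta> :: real
  assumes "CARD('n) \<ge> 2"
    and "0 < c" and "c < 1"
    and "E \<in> UP c"
    and "\<beta> = ln 2 / ln (3 / c)"
  shows "(\<forall>a\<in>E. \<forall>r. 0 < r \<and> r < diameter E / 2 \<longrightarrow>
            hausdorff_content \<beta> (E \<inter> cball a r) \<ge> ennreal (r powr \<beta> / (2 * 3 ^ CARD('n))))
         \<and> hausdorff_dim E \<ge> ennreal (ln 2 / ln (3 / c))"
proof -
  have E: "compact E" "\<exists>x\<in>E. \<exists>y\<in>E. x \<noteq> y"
    using assms(4) by (auto simp: UP_def)
  have ln_pos: "0 < ln (3 / c)"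
    using assms(2,3) by simp
  then have \<beta>_pos: "0 < \<beta>"
    by (simp add: assms(5))
  have "\<beta> * ln (c / 3) = - ln 2"
    using ln_pos assms(2) by (simp add: assms(5) ln_div field_simps)
  then have q: "(c / 3) powr \<beta> = 1 / 2"
    using assms(2) by (simp add: powr_def exp_minus)
  have content: "ennreal (r powr \<beta> / (2 * 3 ^ CARD('n))) \<le> hausdorff_content \<beta> (E \<inter> cball a r)"
    if "a \<in> E" "0 < r" "r < diameter E / 2" for a r
  proof -
    obtain h where "binary_branching E h (c / 3) r"
      using UP_binary_branching[OF assms(4,2,3) \<open>r < diameter E / 2\<close>] .
    then show ?thesis
      using E(1) that \<beta>_pos q by (intro hausdorff_content_branching_ge) auto
  qed
  obtain a y where a: "a \<in> E" "y \<in> E" "a \<noteq> y"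
    using E(2) by blast
  have "dist a y \<le> diameter E"
    using a compact_imp_bounded[OF E(1)] by (intro diameter_bounded_bound)
  with a(3) have diam: "0 < diameter E"
    using zero_less_dist_iff[of a y] by linarith
  have "0 < hausdorff_content \<beta> E"
  proof -
    have "0 < ennreal ((diameter E / 4) powr \<beta> / (2 * 3 ^ CARD('n)))"
      using diam by simp
    also have "\<dots> \<le> hausdorff_content \<beta> (E \<inter> cball a (diameter E / 4))"
      using a(1) diam by (intro content) auto
    also have "\<dots> \<le> hausdorff_content \<beta> E"
      by (intro hausdorff_content_mono) auto
    finally show ?thesis .
  qed
  then have "\<beta> \<le> s" if "0 < s" "hausdorff_measure s E = 0" for s
    using hausdorff_content_eq_0[OF that(1) _ that(2), of \<beta>] by fastforce
  then have "ennreal \<beta> \<le> hausdorff_dim E"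
    unfolding hausdorff_dim_def by (intro Inf_greatest) (auto intro: ennreal_leI)
  with content show ?thesis
    unfolding assms(5) by blast
qed

end
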